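(* Let $\mathcal{S}$ be a finite set of circles in the plane (several circles of equal radius allowed) of total area $1$, i.e. with radii $r_1,\dots,r_n>0$ satisfying $\sum_{i=1}^n \pi r_i^2=1$, and let $S$ be a square of edge length $4/\sqrt{\pi}$. Then $\mathcal{S}$ can be packed into $S$.
   Context: The area of a circle is the area of the disk it bounds. A set of circles can be packed into a region if closed disks of the given radii can be placed (by translation) entirely inside the closed region with pairwise disjoint interiors. *)

theory Defs
  imports "HOL-Analysis.Analysis"
begin

text \<open>Closed squares of edge length \<open>a\<close>, in any position and orientation: \<open>p\<close> is a vertex and
  the orthonormal vectors \<open>u\<close>, \<open>v\<close> are the directions of the edges at \<open>p\<close>.\<close>

definition is_square :: "real \<Rightarrow> (real^2) set \<Rightarrow> bool" where
  "is_square a S \<longleftrightarrow> a > 0 \<and>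
     (\<exists>p u v. norm u = 1 \<and> norm v = 1 \<and> u \<bullet> v = 0 \<and>
        S = {p + s *\<^sub>R u + t *\<^sub>R v | s t. s \<in> {0..a} \<and> t \<in> {0..a}})"

text \<open>The circles are given as a family of radii, so equal radii may be repeated. A translate of the
  closed disk of radius \<open>r i\<close> is determined by its centre \<open>c i\<close>.\<close>

definition can_be_packed :: "'i set \<Rightarrow> ('i \<Rightarrow> real) \<Rightarrow> (real^2) set \<Rightarrow> bool" where
  "can_be_packed I r S \<longleftrightarrow>
     (\<exists>c :: 'i \<Rightarrow> real^2.
        (\<forall>i\<in>I. cball (c i) (r i) \<subseteq> S) \<and>
        (\<forall>i\<in>I. \<forall>j\<in>I. i \<noteq> j \<longrightarrow>
           interior (cball (c i) (r i)) \<inter> interior (cball (c j) (r j)) = {}))"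

end

theory Submission
  imports Defs
begin

text \<open>Let \<open>L\<close> be the edge length of the square. Enclose a disk of radius \<open>r\<close> in a square of edge
  length \<open>L / 2 ^ k\<close>, where \<open>k\<close> is the largest exponent with \<open>2 r \<le> L / 2 ^ k\<close>. The maximality of \<open>k\<close>
  gives \<open>L / 2 ^ k < 4 r\<close>, so this square has area at most \<open>16 r\<^sup>2\<close>, and the enclosing squares have
  total area at most \<open>16 / pi = L\<^sup>2\<close>. Dyadic squares of total area at most \<open>L\<^sup>2\<close> can be placed
  greedily, the largest first: every cell of the grid of mesh \<open>L / 2 ^ k\<close> is then either inside one
  of the squares placed so far or disjoint from all of them, and by area some cell is free.\<close>

text \<open>A grid cell is encoded by the integer coordinates of its lower corner, in units of the
  mesh. Halving the mesh \<open>d\<close> times cuts the cell \<open>p\<close> into exactly these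
  cells.\<close>

definition dyadic_block :: "nat \<Rightarrow> nat \<times> nat \<Rightarrow> (nat \<times> nat) set" where
  "dyadic_block d p =
     {fst p * 2 ^ d ..< (fst p + 1) * 2 ^ d} \<times> {snd p * 2 ^ d ..< (snd p + 1) * 2 ^ d}"

lemma finite_dyadic_block [simp]: "finite (dyadic_block d p)"
  by (simp add: dyadic_block_def)

lemma card_dyadic_block: "card (dyadic_block d p) = 4 ^ d"
  by (simp add: dyadic_block_def card_cartesian_product flip: power_mult_distrib)

lemma dyadic_block_0 [simp]: "dyadic_block 0 p = {p}"
  by (cases p) (auto simp: dyadic_block_def)

text \<open>Here \<open>p i\<close> is a cell of the grid with \<open>2 ^ k i\<close> cells per
  side. Dyadic cells are nested or have disjoint interiors, so it is enough to keep the finer cell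
  out of the block of the coarser one.\<close>

lemma dyadic_packing:
  fixes k :: "'i \<Rightarrow> nat"
  assumes "finite I" and "(\<Sum>i\<in>I. 1 / 4 ^ k i) \<le> (1::real)"
  shows "\<exists>p. (\<forall>i\<in>I. p i \<in> {..<2 ^ k i} \<times> {..<2 ^ k i}) \<and>
             (\<forall>i\<in>I. \<forall>j\<in>I. i \<noteq> j \<longrightarrow> k i \<le> k j \<longrightarrow> p j \<notin> dyadic_block (k j - k i) (p i))"
  using assms
\<comment> \<open>The index added last has the largest \<open>k\<close>, hence the smallest square.
  The rule lets it lie in \<open>I\<close> already, whence the case split.\<close>
proof (induction I rule: finite_ranking_induct[where f = k])
  case empty
  then show ?case by simp
next
  case (insert x I)
  show ?case
  proof (cases "x \<in> I")
    case True
    with insert show ?thesis by (simp add: insert_absorb)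
  next
    case False
    have sum_le: "(\<Sum>i\<in>I. 1 / 4 ^ k i) + 1 / 4 ^ k x \<le> (1::real)"
      using insert.prems insert.hyps False by simp
    then have "(\<Sum>i\<in>I. 1 / 4 ^ k i) \<le> (1::real)"
      by (smt (verit) zero_less_divide_iff zero_less_power)
    from insert.IH[OF this] obtain p where
      p_range: "\<forall>i\<in>I. p i \<in> {..<2 ^ k i} \<times> {..<2 ^ k i}" and
      p_disj: "\<forall>i\<in>I. \<forall>j\<in>I. i \<noteq> j \<longrightarrow> k i \<le> k j \<longrightarrow> p j \<notin> dyadic_block (k j - k i) (p i)"
      by (elim exE conjE)
    define B where "B = (\<Union>i\<in>I. dyadic_block (k x - k i) (p i))"
    have "card B \<le> (\<Sum>i\<in>I. 4 ^ (k x - k i))"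
      unfolding B_def using card_UN_le[OF \<open>finite I\<close>, of "\<lambda>i. dyadic_block (k x - k i) (p i)"]
      by (simp add: card_dyadic_block)
    then have "real (card B) \<le> real (\<Sum>i\<in>I. 4 ^ (k x - k i))"
      by (simp only: of_nat_le_iff)
    also have "\<dots> = (\<Sum>i\<in>I. 4 ^ (k x - k i))"
      by simp
    also have "\<dots> = 4 ^ k x * (\<Sum>i\<in>I. 1 / 4 ^ k i)"
      using insert.hyps by (simp add: sum_distrib_left power_diff)
    \<comment> \<open>The square of \<open>x\<close> itself counts in the total area, so the earlier
      squares leave room for at least one cell of its mesh.\<close>
    also have "\<dots> \<le> 4 ^ k x * (1 - 1 / 4 ^ k x)"
      using sum_le by (intro mult_left_mono) auto
    also have "\<dots> < 4 ^ k x"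
      by (simp add: algebra_simps)
    also have "\<dots> = real (card ({..<2 ^ k x} \<times> {..<2 ^ k x} :: (nat \<times> nat) set))"
      by (simp add: card_cartesian_product flip: power_mult_distrib)
    finally have "card B < card ({..<2 ^ k x} \<times> {..<2 ^ k x} :: (nat \<times> nat) set)"
      by (simp only: of_nat_less_iff)
    moreover have "finite B"
      unfolding B_def using insert.hyps by simp
    ultimately obtain q where q: "q \<in> {..<2 ^ k x} \<times> {..<2 ^ k x}" "q \<notin> B"
      using card_mono[of B "{..<2 ^ k x} \<times> {..<2 ^ k x}"] by (meson leD subsetI)
    show ?thesis
    proof (intro exI[of _ "p(x := q)"] conjI ballI impI)
      fix i assume "i \<in> insert x I"
      then show "(p(x := q)) i \<in> {..<2 ^ k i} \<times> {..<2 ^ k i}"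
        using p_range q by auto
    next
      fix i j assume ij: "i \<in> insert x I" "j \<in> insert x I" "i \<noteq> j" "k i \<le> k j"
      consider "i \<in> I" "j \<in> I" | "i \<in> I" "j = x" | "i = x" "j \<in> I"
        using ij by blast
      then show "(p(x := q)) j \<notin> dyadic_block (k j - k i) ((p(x := q)) i)"
      proof cases
        case 1
        then show ?thesis using p_disj ij False by (metis fun_upd_other)
      next
        case 2
        then show ?thesis using q(2) False by (auto simp: B_def)
      next
        case 3
        \<comment> \<open>As \<open>k x\<close> is maximal, the two meshes agree and the block of
          \<open>q\<close> is the single cell \<open>q\<close>.\<close>
        then have "k j = k x" using ij insert.hyps by force
        then have "p j \<noteq> q" using q(2) 3 unfolding B_def by force
        then show ?thesis using 3 False \<open>k j = k x\<close> by auto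
      qed
    qed
  qed
qed

text \<open>Take the least \<open>k\<close> satisfying the second inequality: its failure at
  \<open>k - 1\<close>, halved, is the first one. For \<open>k = 0\<close> the hypothesis
  \<open>y \<le> 1\<close> serves instead.\<close>

lemma dyadic_round_up:
  fixes y :: real
  assumes "0 < y" "y \<le> 1"
  shows "\<exists>k. y \<le> 1 / 2 ^ k \<and> 1 / 2 ^ k < 2 * y"
proof -
  have ex: "\<exists>n. 1 / 2 ^ n < 2 * y"
    using real_arch_pow_inv[of "2 * y" "1 / 2"] assms by (auto simp: power_one_over)
  define k where "k = (LEAST n. 1 / 2 ^ n < 2 * y)"
  have "1 / 2 ^ k < 2 * y"
    unfolding k_def using ex by (rule LeastI_ex)
  moreover have "y \<le> 1 / 2 ^ k"
  proof (cases k)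
    case 0
    then show ?thesis using assms by simp
  next
    case (Suc m)
    then have "\<not> 1 / 2 ^ m < 2 * y"
      using not_less_Least[of m "\<lambda>n. 1 / 2 ^ n < 2 * y"] by (simp add: k_def)
    then show ?thesis using Suc by simp
  qed
  ultimately show ?thesis by blast
qed

text \<open>The square may be rotated, so points are read in coordinates along its edges. Orthogonal
  unit vectors are independent and, by dimension, span the plane.\<close>

lemma orthonormal_pair_expansion:
  fixes u v x :: "real^2"
  assumes "norm u = 1" "norm v = 1" "u \<bullet> v = 0"
  shows "x = (x \<bullet> u) *\<^sub>R u + (x \<bullet> v) *\<^sub>R v"
proof -
  have uv: "u \<bullet> u = 1" "v \<bullet> v = 1" "v \<bullet> u = 0"
    using assms by (simp_all add: norm_eq_1 inner_commute)
  then have "u \<noteq> v" "u \<noteq> 0" "v \<noteq> 0" by auto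
  then have "independent {u, v}"
    using assms uv by (intro pairwise_orthogonal_independent)
      (auto simp: pairwise_def orthogonal_def)
  then have "span {u, v} = UNIV"
    using card_eq_dim[of "{u, v}" UNIV] \<open>u \<noteq> v\<close> by auto
  then show ?thesis
    using uv assms(3)
    by (intro vector_eq_dot_span[of _ "{u, v}"])
       (auto simp: inner_add_right inner_commute)
qed

text \<open>Projection onto a line does not increase distances, so a gap in one direction bounds the
  distance of the centres from below.\<close>

lemma disjoint_balls_if_separated:
  fixes x y u :: "'a::euclidean_space"
  assumes "norm u = 1" and "r + s \<le> \<bar>(x - y) \<bullet> u\<bar>"
  shows "interior (cball x r) \<inter> interior (cball y s) = {}"
proof -
  have "r + s \<le> dist x y"
    using assms Cauchy_Schwarz_ineq2[of "x - y" u] by (simp add: dist_norm)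
  then show ?thesis
    using dist_triangle_less_add[of x _ r y s] by (force simp: dist_commute)
qed

theorem theorem10p1:
  fixes n :: nat and r :: "nat \<Rightarrow> real" and S :: "(real^2) set"
  assumes "\<And>i. i \<in> {1..n} \<Longrightarrow> r i > 0"
    and "(\<Sum>i=1..n. pi * (r i)\<^sup>2) = 1"
    and "is_square (4 / sqrt pi) S"
  shows "can_be_packed {1..n} r S"
proof -
  define L where "L = 4 / sqrt pi"
  have L: "L > 0" "L\<^sup>2 = 16 / pi"
    by (auto simp: L_def power_divide)
  obtain p u v where uv: "norm u = 1" "norm v = 1" "u \<bullet> v = 0"
    and S: "S = {p + s *\<^sub>R u + t *\<^sub>R v | s t. s \<in> {0..L} \<and> t \<in> {0..L}}"
    using assms(3) unfolding is_square_def L_def by blast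
  have "\<exists>k. 2 * r i \<le> L / 2 ^ k \<and> 1 / 4 ^ k \<le> pi * (r i)\<^sup>2" if i: "i \<in> {1..n}" for i
  proof -
    define y where "y = 2 * r i / L"
    have "y > 0" using assms(1)[OF i] L by (simp add: y_def)
    \<comment> \<open>The edge length enters here: \<open>L\<^sup>2 = 16 / pi\<close> turns
      \<open>16 * (r i)\<^sup>2 / L\<^sup>2\<close> into the area of the disk.\<close>
    have y2: "(2 * y)\<^sup>2 = pi * (r i)\<^sup>2"
      by (simp add: y_def power_divide power_mult_distrib L)
    have "pi * (r i)\<^sup>2 \<le> (\<Sum>i=1..n. pi * (r i)\<^sup>2)"
      using i by (intro member_le_sum) auto
    then have "2 * y \<le> 1"
      using assms(2) y2 power2_le_imp_le[of "2 * y" 1] by simp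
    with \<open>y > 0\<close> obtain k where k: "y \<le> 1 / 2 ^ k" "1 / 2 ^ k < 2 * y"
      using dyadic_round_up[of y] by auto
    have "1 / 4 ^ k = (1 / 2 ^ k :: real)\<^sup>2"
      by (simp add: power2_eq_square flip: power_mult_distrib)
    also have "\<dots> \<le> (2 * y)\<^sup>2"
      using k(2) by (intro power_mono) auto
    finally show ?thesis
      using k(1) L y2 by (intro exI[of _ k]) (simp add: y_def field_simps)
  qed
  then obtain k where k: "\<And>i. i \<in> {1..n} \<Longrightarrow> 2 * r i \<le> L / 2 ^ k i"
    and k_area: "\<And>i. i \<in> {1..n} \<Longrightarrow> 1 / 4 ^ k i \<le> pi * (r i)\<^sup>2"
    by metis
  have "(\<Sum>i=1..n. 1 / 4 ^ k i) \<le> (\<Sum>i=1..n. pi * (r i)\<^sup>2)"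
    by (intro sum_mono k_area)
  then have "(\<Sum>i=1..n. 1 / 4 ^ k i) \<le> (1::real)"
    unfolding assms(2) .
  from dyadic_packing[OF finite_atLeastAtMost this] obtain q where
    q_range: "\<forall>i\<in>{1..n}. q i \<in> {..<2 ^ k i} \<times> {..<2 ^ k i}" and
    q_disj: "\<forall>i\<in>{1..n}. \<forall>j\<in>{1..n}. i \<noteq> j \<longrightarrow> k i \<le> k j \<longrightarrow>
               q j \<notin> dyadic_block (k j - k i) (q i)"
    by (elim exE conjE)
  \<comment> \<open>The midpoint of interval number \<open>m\<close>, counted from 0, when the edge
    is cut into \<open>2 ^ k i\<close> equal parts; each disk is centred in its cell.\<close>
  define mid where "mid m i = (real m + 1 / 2) * (L / 2 ^ k i)" for m i
  define c where "c i = p + mid (fst (q i)) i *\<^sub>R u + mid (snd (q i)) i *\<^sub>R v" for i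
  have c_inner: "(c i - p) \<bullet> u = mid (fst (q i)) i" "(c i - p) \<bullet> v = mid (snd (q i)) i" for i
    using uv by (simp_all add: c_def inner_add_left norm_eq_1 inner_commute[of v u])
  have in_range: "t \<in> {0..L}"
    if "i \<in> {1..n}" "m < 2 ^ k i" "\<bar>t - mid m i\<bar> \<le> r i" for i m t
  proof -
    have "real (m + 1) \<le> 2 ^ k i"
      using that(2) by (metis Suc_eq_plus1 Suc_leI of_nat_le_iff of_nat_numeral of_nat_power)
    define h where "h = L / 2 ^ k i"
    have h: "h > 0" "2 ^ k i * h = L" using L by (simp_all add: h_def)
    have "(real m + 1) * h \<le> 2 ^ k i * h"
      using \<open>real (m + 1) \<le> 2 ^ k i\<close> h by (intro mult_right_mono) auto
    then have "real m * h + h \<le> L" unfolding h(2) by (simp add: algebra_simps)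
    moreover have "0 \<le> real m * h" using h by simp
    moreover have "mid m i = real m * h + h / 2"
      unfolding mid_def h_def[symmetric] by (simp add: distrib_right)
    moreover have "2 * r i \<le> h" using k[OF that(1)] by (simp add: h_def)
    ultimately show ?thesis
      using that(3) unfolding atLeastAtMost_iff by linarith
  qed
  have inside: "cball (c i) (r i) \<subseteq> S" if i: "i \<in> {1..n}" for i
  proof
    fix x assume x: "x \<in> cball (c i) (r i)"
    have coord: "\<bar>(x - p) \<bullet> w - (c i - p) \<bullet> w\<bar> \<le> r i" if "norm w = 1" for w
      using x Cauchy_Schwarz_ineq2[of "x - c i" w] that
      by (simp add: dist_norm norm_minus_commute flip: inner_diff_left)
    have "(x - p) \<bullet> u \<in> {0..L}" "(x - p) \<bullet> v \<in> {0..L}"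
      using in_range[OF i] coord[OF uv(1)] coord[OF uv(2)] bspec[OF q_range i]
      by (auto simp: c_inner mem_Times_iff)
    moreover have "x = p + ((x - p) \<bullet> u) *\<^sub>R u + ((x - p) \<bullet> v) *\<^sub>R v"
      using orthonormal_pair_expansion[OF uv, of "x - p"] by (simp add: algebra_simps)
    ultimately show "x \<in> S" unfolding S by blast
  qed
  \<comment> \<open>Along one edge the finer interval \<open>m'\<close> does not overlap the coarser
    interval \<open>m\<close>, so the midpoints are at least half the sum of the lengths apart, and
    each half length is at least the radius.\<close>
  have separated: "r i + r j \<le> \<bar>mid m' j - mid m i\<bar>"
    if ij: "i \<in> {1..n}" "j \<in> {1..n}" "k i \<le> k j"
      and m: "m' \<notin> {m * 2 ^ (k j - k i) ..< (m + 1) * 2 ^ (k j - k i)}" for i j m m'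
  proof -
    define g h where "g = L / 2 ^ k i" and "h = L / 2 ^ k j"
    have h: "h > 0" "g = 2 ^ (k j - k i) * h"
      using L ij(3) by (simp_all add: g_def h_def power_diff)
    have r: "2 * r i \<le> g" "2 * r j \<le> h"
      using k[OF ij(1)] k[OF ij(2)] by (simp_all add: g_def h_def)
    have mid: "mid m i = real m * g + g / 2" "mid m' j = real m' * h + h / 2"
      unfolding mid_def g_def[symmetric] h_def[symmetric] by (simp_all add: distrib_right)
    consider "m' + 1 \<le> m * 2 ^ (k j - k i)" | "(m + 1) * 2 ^ (k j - k i) \<le> m'"
      using m by force
    then show ?thesis
    proof cases
      case 1
      then have "real (m' + 1) \<le> real (m * 2 ^ (k j - k i))"
        by (simp only: of_nat_le_iff)
      then have "(real m' + 1) * h \<le> (real m * 2 ^ (k j - k i)) * h"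
        using h by (intro mult_right_mono) auto
      then have "real m' * h + h \<le> real m * g"
        unfolding h(2) by (simp add: algebra_simps)
      then show ?thesis
        using r unfolding mid by linarith
    next
      case 2
      then have "real ((m + 1) * 2 ^ (k j - k i)) \<le> real m'"
        by (simp only: of_nat_le_iff)
      then have "((real m + 1) * 2 ^ (k j - k i)) * h \<le> real m' * h"
        using h by (intro mult_right_mono) (auto simp: distrib_right)
      then have "real m * g + g \<le> real m' * h"
        unfolding h(2) by (simp add: algebra_simps)
      then show ?thesis
        using r unfolding mid by linarith
    qed
  qed
  have disjoint: "interior (cball (c i) (r i)) \<inter> interior (cball (c j) (r j)) = {}"
    if ij: "i \<in> {1..n}" "j \<in> {1..n}" "i \<noteq> j" "k i \<le> k j" for i j
  proof -
    have diff: "(c i - c j) \<bullet> w = (c i - p) \<bullet> w - (c j - p) \<bullet> w" for w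
      by (simp add: inner_diff_left)
    \<comment> \<open>The block is a product, so a cell outside it misses it in some coordinate, and
      that edge direction separates the disks.\<close>
    have "r i + r j \<le> \<bar>(c i - c j) \<bullet> u\<bar> \<or> r i + r j \<le> \<bar>(c i - c j) \<bullet> v\<bar>"
      using q_disj[rule_format, OF ij] separated[OF ij(1,2,4)]
      unfolding dyadic_block_def mem_Times_iff diff c_inner by (metis abs_minus_commute)
    then show ?thesis
      using disjoint_balls_if_separated uv by blast
  qed
  \<comment> \<open>By symmetry the index of the coarser cell may be named first.\<close>
  have "\<forall>i\<in>{1..n}. \<forall>j\<in>{1..n}. i \<noteq> j \<longrightarrow>
      interior (cball (c i) (r i)) \<inter> interior (cball (c j) (r j)) = {}"
    using disjoint by (metis Int_commute nat_le_linear)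
  with inside show ?thesis
    unfolding can_be_packed_def by blast
qed

end
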